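(* Consider the semi-discrete numerical approximation described in the context, with solution $\mathbf u:[0,T]\to\mathbb R^N$, with penalty parameters $\tau_L=-\tau_R=1$ and homogeneous boundary data $\mathbf b_L=\mathbf b_R=\mathbf 0$. If the real boundary parameters satisfy $\alpha_L^2+\beta_L^2\ne0$, $\alpha_R^2+\beta_R^2\ne0$, $\alpha_L\beta_L\le0$, $\alpha_R\beta_R\ge0$ and $\alpha_L,\alpha_R$ are nonzero, then in a source-free medium ($\mathbf S=\mathbf 0$) the semi-discrete energy $\mathcal E$ satisfies $$\mathcal E(t)+\int_0^t\left(\left\|\mathbf c^{-1}\pmb\sigma\left.\frac{d\mathbf u}{dt}\right|_{t=s}\right\|_{H_x}^2+\operatorname{BT}_h(s)\right)ds=\mathcal E(0)\qquad\forall t\in[0,T],$$ where $\operatorname{BT}_h(t)=\frac{\beta_R}{\alpha_R}\left(\frac{du_N}{dt}\right)^2-\frac{\beta_L}{\alpha_L}\left(\frac{du_1}{dt}\right)^2\ge0$.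
   Context: Space grid: $\Omega=[x_L,x_R]$, uniform points $x_1=x_L,\dots,x_N=x_R$, $\Delta x=(x_R-x_L)/(N-1)$; for a function $f$ on $\Omega$, $\mathbf f=[f(x_1),\dots,f(x_N)]^\top$. A triplet $(D_x^-,D_x^+,H_x)$ of linear operators on $\mathbb R^N$ satisfies the dual-pairing summation-by-parts (DP-SBP) framework if: (A.1) $H_x$ defines a positive discrete measure: with $(\mathbf f,\mathbf g)_{H_x}=\mathbf f^\top H_x\mathbf g$, $(\mathbf f,\mathbf f)_{H_x}>0$ for all $\mathbf f\ne\mathbf 0$, and $(\mathbf 1,\mathbf f)_{H_x}=\sum_{i=1}^N h_if(x_i)\Delta x\to\int_{x_L}^{x_R}f\,dx$ weakly as $N\to\infty$ for any $f\in L^2(\Omega)$; (A.2) $(D_x^\pm\mathbf f)_i=f'(x_i)$ for all polynomials $f$ of degree at most $p$; (A.3) $(D_x^+\mathbf f,\mathbf g)_{H_x}+(\mathbf f,D_x^-\mathbf g)_{H_x}=f_Ng_N-f_1g_1$ for all $\mathbf f,\mathbf g\in\mathbb R^N$; (A.4) $(\mathbf f,(D_x^+-D_x^-)\mathbf f)_{H_x}\le0$ for all $\mathbf f\in\mathbb R^N$. Write $\|\mathbf f\|_{H_x}^2=(\mathbf f,\mathbf f)_{H_x}$. Let $(D_x^-,D_x^+,H_x)$ be such a triplet. $\mathbf c=\operatorname{diag}(c(x_1),\dots,c(x_N))$ with $c(x)\neq0$ the wave speed, $\pmb\sigma=\operatorname{diag}(\sigma(x_1),\dots,\sigma(x_N))$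 with $\sigma$ the damping coefficient; $e_1,e_N\in\mathbb R^N$ are the first and last standard basis vectors; $\mathbf S(t)\in\mathbb R^N$ is the source grid function; $\mathbf b_L(t)=b_L(t)e_1$, $\mathbf b_R(t)=b_R(t)e_N$ are boundary data; $\mathbf f,\mathbf g\in\mathbb R^N$ are initial data. The semi-discrete approximation for $\mathbf u=[u_1,\dots,u_N]^\top$ is $$\frac{d^2\mathbf u}{dt^2}+\pmb\sigma^2\frac{d\mathbf u}{dt}=\mathbf c^2D_x^+D_x^-\mathbf u+\mathbf S(t)+\tau_L\mathbf c^2H_x^{-1}e_1e_1^\top\left(D_x^-\mathbf u+\frac{\beta_L}{\alpha_L}\frac{d\mathbf u}{dt}-\frac1{\alpha_L}\mathbf b_L(t)\right)+\tau_R\mathbf c^2H_x^{-1}e_Ne_N^\top\left(D_x^-\mathbf u+\frac{\beta_R}{\alpha_R}\frac{d\mathbf u}{dt}-\frac1{\alpha_R}\mathbf b_R(t)\right),$$ $\mathbf u(0)=\mathbf f$, $\frac{d\mathbf u}{dt}|_{t=0}=\mathbf g$, for $t\in[0,T]$. The semi-discrete energy is $\mathcal E(t)=\frac12\left(\left\|\mathbf c^{-1}\frac{d\mathbf u}{dt}\right\|_{H_x}^2+\|D_x^-\mathbf u\|_{H_x}^2\right)$. *)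

theory Defs
  imports "HOL-Analysis.Analysis" "Jordan_Normal_Form.Gauss_Jordan_Elimination"
begin

(* "$" and "\<bullet>" denote indexing and scalar product of the carrier-based type "real vec",
   whose dimension N is a natural number. Components are numbered 0, ..., N - 1. *)
unbundle no vec_syntax
unbundle no inner_syntax
hide_const (open) Finite_Cartesian_Product.vec

definition grid_spacing :: "real \<Rightarrow> real \<Rightarrow> nat \<Rightarrow> real" where
  "grid_spacing xL xR N = (xR - xL) / (real N - 1)"

definition grid_point :: "real \<Rightarrow> real \<Rightarrow> nat \<Rightarrow> nat \<Rightarrow> real" where
  "grid_point xL xR N i = xL + real i * grid_spacing xL xR N"

definition grid_fun :: "real \<Rightarrow> real \<Rightarrow> nat \<Rightarrow> (real \<Rightarrow> real) \<Rightarrow> real vec" where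
  "grid_fun xL xR N f = vec N (\<lambda>i. f (grid_point xL xR N i))"

definition grid_diag :: "real \<Rightarrow> real \<Rightarrow> nat \<Rightarrow> (real \<Rightarrow> real) \<Rightarrow> real mat" where
  "grid_diag xL xR N f = mat_diag N (\<lambda>i. f (grid_point xL xR N i))"

definition weighted_inner :: "real mat \<Rightarrow> real vec \<Rightarrow> real vec \<Rightarrow> real" where
  "weighted_inner H f g = f \<bullet> (H *\<^sub>v g)"

definition weighted_norm_sq :: "real mat \<Rightarrow> real vec \<Rightarrow> real" where
  "weighted_norm_sq H f = weighted_inner H f f"

definition matinv :: "real mat \<Rightarrow> real mat" where
  "matinv A = the (mat_inverse A)"

definition outer_product :: "real vec \<Rightarrow> real vec \<Rightarrow> real mat" where
  "outer_product v w = mat (dim_vec v) (dim_vec w) (\<lambda>(i, j). v $ i * w $ j)"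

(* The algebraic requirements on a triplet for a fixed number N of grid points. That H is a
   discrete measure means that it is given by quadrature weights h i * grid_spacing attached to
   the grid points, i.e. that it is diagonal. *)
definition dp_sbp_at ::
  "real \<Rightarrow> real \<Rightarrow> nat \<Rightarrow> nat \<Rightarrow> real mat \<Rightarrow> real mat \<Rightarrow> real mat \<Rightarrow> bool" where
  "dp_sbp_at xL xR p N Dm Dp H \<longleftrightarrow>
     Dm \<in> carrier_mat N N \<and> Dp \<in> carrier_mat N N \<and>
     (\<exists>h :: nat \<Rightarrow> real. H = mat_diag N (\<lambda>i. h i * grid_spacing xL xR N)) \<and>
     (\<forall>f\<in>carrier_vec N. f \<noteq> 0\<^sub>v N \<longrightarrow> weighted_inner H f f > 0) \<and>
     (\<forall>q :: real poly. degree q \<le> p \<longrightarrow> (\<forall>i<N.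
        (Dm *\<^sub>v grid_fun xL xR N (poly q)) $ i = poly (pderiv q) (grid_point xL xR N i) \<and>
        (Dp *\<^sub>v grid_fun xL xR N (poly q)) $ i = poly (pderiv q) (grid_point xL xR N i))) \<and>
     (\<forall>f\<in>carrier_vec N. \<forall>g\<in>carrier_vec N.
        weighted_inner H (Dp *\<^sub>v f) g + weighted_inner H f (Dm *\<^sub>v g)
          = f $ (N - 1) * g $ (N - 1) - f $ 0 * g $ 0) \<and>
     (\<forall>f\<in>carrier_vec N. weighted_inner H f ((Dp - Dm) *\<^sub>v f) \<le> 0)"

(* A family of triplets, one for each N \<ge> N0 (operators of a given order p exist only on
   sufficiently many grid points). The last conjunct is the convergence of (1, f)_H to the
   integral of f as weak convergence of the discrete measures to the Lebesgue measure, i.e. tested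
   against continuous f: elements of L^2 have no point values, and sampling arbitrary
   representatives would make the condition unsatisfiable. *)
definition dp_sbp ::
  "real \<Rightarrow> real \<Rightarrow> nat \<Rightarrow> nat \<Rightarrow> (nat \<Rightarrow> real mat) \<Rightarrow> (nat \<Rightarrow> real mat) \<Rightarrow> (nat \<Rightarrow> real mat) \<Rightarrow> bool"
  where
  "dp_sbp xL xR p N0 Dm Dp H \<longleftrightarrow>
     (\<forall>N\<ge>N0. dp_sbp_at xL xR p N (Dm N) (Dp N) (H N)) \<and>
     (\<forall>f :: real \<Rightarrow> real. continuous_on {xL..xR} f \<longrightarrow>
        (\<lambda>N. weighted_inner (H N) (grid_fun xL xR N (\<lambda>x. 1)) (grid_fun xL xR N f))
          \<longlonglongrightarrow> integral {xL..xR} f)"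

(* "real vec" carries no topology, so curves in R^N are differentiated componentwise; at the end
   points of I the derivative is one-sided. *)
definition has_grid_derivative ::
  "nat \<Rightarrow> real set \<Rightarrow> (real \<Rightarrow> real vec) \<Rightarrow> (real \<Rightarrow> real vec) \<Rightarrow> bool" where
  "has_grid_derivative N I u v \<longleftrightarrow>
     (\<forall>t\<in>I. u t \<in> carrier_vec N \<and> v t \<in> carrier_vec N \<and>
       (\<forall>i<N. ((\<lambda>s. u s $ i) has_real_derivative v t $ i) (at t within I)))"

(* The arguments ut and utt are the first and second time derivatives of u. *)
definition semidiscrete_solution ::
  "real \<Rightarrow> real \<Rightarrow> nat \<Rightarrow> real mat \<Rightarrow> real mat \<Rightarrow> real mat \<Rightarrow> (real \<Rightarrow> real) \<Rightarrow> (real \<Rightarrow> real) \<Rightarrow>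
   (real \<Rightarrow> real vec) \<Rightarrow> real \<Rightarrow> real \<Rightarrow> real \<Rightarrow> real \<Rightarrow> real \<Rightarrow> real \<Rightarrow>
   (real \<Rightarrow> real) \<Rightarrow> (real \<Rightarrow> real) \<Rightarrow> real vec \<Rightarrow> real vec \<Rightarrow> real \<Rightarrow>
   (real \<Rightarrow> real vec) \<Rightarrow> (real \<Rightarrow> real vec) \<Rightarrow> (real \<Rightarrow> real vec) \<Rightarrow> bool" where
  "semidiscrete_solution xL xR N Dm Dp H c \<sigma> S \<tau>L \<tau>R \<alpha>L \<beta>L \<alpha>R \<beta>R bL bR f g T u ut utt \<longleftrightarrow>
     has_grid_derivative N {0..T} u ut \<and> has_grid_derivative N {0..T} ut utt \<and>
     u 0 = f \<and> ut 0 = g \<and>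
     (let C = grid_diag xL xR N c; Sg = grid_diag xL xR N \<sigma>;
          e1 = unit_vec N 0; eN = unit_vec N (N - 1)
      in \<forall>t\<in>{0..T}.
        utt t + (Sg ^\<^sub>m 2) *\<^sub>v ut t =
          ((C ^\<^sub>m 2) * Dp * Dm) *\<^sub>v u t + S t
          + \<tau>L \<cdot>\<^sub>v (((C ^\<^sub>m 2) * matinv H * outer_product e1 e1) *\<^sub>v
              (Dm *\<^sub>v u t + (\<beta>L / \<alpha>L) \<cdot>\<^sub>v ut t - (1 / \<alpha>L) \<cdot>\<^sub>v (bL t \<cdot>\<^sub>v e1)))
          + \<tau>R \<cdot>\<^sub>v (((C ^\<^sub>m 2) * matinv H * outer_product eN eN) *\<^sub>v
              (Dm *\<^sub>v u t + (\<beta>R / \<alpha>R) \<cdot>\<^sub>v ut t - (1 / \<alpha>R) \<cdot>\<^sub>v (bR t \<cdot>\<^sub>v eN))))"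

definition semidiscrete_energy ::
  "real \<Rightarrow> real \<Rightarrow> nat \<Rightarrow> real mat \<Rightarrow> real mat \<Rightarrow> (real \<Rightarrow> real) \<Rightarrow>
   (real \<Rightarrow> real vec) \<Rightarrow> (real \<Rightarrow> real vec) \<Rightarrow> real \<Rightarrow> real" where
  "semidiscrete_energy xL xR N Dm H c u ut t =
     1 / 2 * (weighted_norm_sq H (matinv (grid_diag xL xR N c) *\<^sub>v ut t)
              + weighted_norm_sq H (Dm *\<^sub>v u t))"

definition boundary_term ::
  "nat \<Rightarrow> real \<Rightarrow> real \<Rightarrow> real \<Rightarrow> real \<Rightarrow> (real \<Rightarrow> real vec) \<Rightarrow> real \<Rightarrow> real" where
  "boundary_term N \<alpha>L \<beta>L \<alpha>R \<beta>R ut t =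
     \<beta>R / \<alpha>R * (ut t $ (N - 1))\<^sup>2 - \<beta>L / \<alpha>L * (ut t $ 0)\<^sup>2"

end

theory Submission
  imports Defs
begin

(* The energy method: differentiate the energy and insert the scheme tested against c^-2 ut. The
   summation-by-parts identity, applied to Dm u and ut, cancels the interior terms and leaves
   ut_N (Dm u)_N - ut_1 (Dm u)_1, which for tau_L = -tau_R = 1 is cancelled by the derivative
   parts of the penalty terms. What survives of the penalties is minus the boundary term, so
   E' = -(damping + boundary term), and integration in time gives the identity. *)

lemma mat_diag_mult_vec:
  assumes "v \<in> carrier_vec n"
  shows "mat_diag n f *\<^sub>v v = vec n (\<lambda>i. f i * v $ i)"
proof (rule eq_vecI)
  fix i assume "i < dim_vec (vec n (\<lambda>i. f i * v $ i))"
  then have i: "i < n" by simp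
  have "(mat_diag n f *\<^sub>v v) $ i = (\<Sum>j<n. (if i = j then f j else 0) * v $ j)"
    using assms i by (auto simp: mat_diag_def scalar_prod_def atLeast0LessThan intro!: sum.cong)
  also have "\<dots> = (\<Sum>j<n. if i = j then f j * v $ j else 0)"
    by (intro sum.cong) auto
  also have "\<dots> = f i * v $ i" using i by simp
  finally show "(mat_diag n f *\<^sub>v v) $ i = vec n (\<lambda>i. f i * v $ i) $ i" using i by simp
qed (simp add: mat_diag_def)

text \<open>\<open>matinv\<close> takes \<open>the\<close> of an option, so success of the inversion
  has to be shown before its value can be used. The reciprocal diagonal is a two-sided inverse,
  which makes the matrix a unit of the matrix ring and excludes \<open>None\<close>; uniqueness of
  inverses then identifies the result.\<close>

lemma matinv_mat_diag:
  assumes "\<And>i. i < n \<Longrightarrow> f i \<noteq> 0"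
  shows "matinv (mat_diag n f) = mat_diag n (\<lambda>i. inverse (f i))"
proof -
  let ?A = "mat_diag n f" and ?B = "mat_diag n (\<lambda>i. inverse (f i))"
  have A: "?A \<in> carrier_mat n n" and B: "?B \<in> carrier_mat n n" by simp_all
  have one: "mat_diag n (\<lambda>i. inverse (f i) * f i) = 1\<^sub>m n"
    using assms by (intro eq_matI) (auto simp: mat_diag_def)
  have BA: "?B * ?A = 1\<^sub>m n" unfolding mat_diag_diag by (rule one)
  have AB: "?A * ?B = 1\<^sub>m n" unfolding mat_diag_diag using one by (simp add: mult.commute)
  have "?A \<in> Units (ring_mat TYPE(real) n ())"
    using A B AB BA by (auto simp: Units_def ring_mat_def simp del: mat_diag_diag)
  then obtain X where X: "mat_inverse ?A = Some X"
    using mat_inverse(1)[OF A, of "()"] by (cases "mat_inverse ?A") auto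
  have "X * ?A = 1\<^sub>m n" and Xc: "X \<in> carrier_mat n n"
    using mat_inverse(2)[OF A X] by auto
  then have "X = X * (?A * ?B)" unfolding AB by simp
  also have "\<dots> = ?B"
    using \<open>X * ?A = 1\<^sub>m n\<close> B by (simp only: assoc_mult_mat[OF Xc A B, symmetric] left_mult_one_mat)
  finally have "X = ?B" .
  with X show ?thesis by (simp add: matinv_def)
qed

lemma weighted_inner_mat_diag:
  assumes "f \<in> carrier_vec n" and "g \<in> carrier_vec n"
  shows "weighted_inner (mat_diag n w) f g = (\<Sum>i<n. w i * (f $ i * g $ i))"
  using assms
  by (auto simp: weighted_inner_def mat_diag_mult_vec scalar_prod_def atLeast0LessThan
      algebra_simps intro!: sum.cong)

lemma outer_product_mult_vec:
  assumes "dim_vec w = dim_vec x"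
  shows "outer_product v w *\<^sub>v x = (w \<bullet> x) \<cdot>\<^sub>v v"
  using assms
  by (intro eq_vecI)
     (auto simp: outer_product_def scalar_prod_def sum_distrib_right intro!: sum.cong)

lemma has_grid_derivative_mult_mat_vec:
  assumes A: "A \<in> carrier_mat n n" and uv: "has_grid_derivative n I u v"
  shows "has_grid_derivative n I (\<lambda>t. A *\<^sub>v u t) (\<lambda>t. A *\<^sub>v v t)"
  unfolding has_grid_derivative_def
proof (intro ballI conjI allI impI)
  fix t i assume t: "t \<in> I" and i: "i < n"
  have expand: "(A *\<^sub>v x) $ i = (\<Sum>j<n. A $$ (i, j) * x $ j)" if "x \<in> carrier_vec n" for x
    using A i that by (auto simp: scalar_prod_def atLeast0LessThan)
  have D: "((\<lambda>s. \<Sum>j<n. A $$ (i, j) * u s $ j) has_real_derivative (A *\<^sub>v v t) $ i)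
      (at t within I)"
    using uv t unfolding has_grid_derivative_def
    by (subst expand) (auto intro!: DERIV_sum DERIV_cmult)
  \<comment> \<open>Outside \<open>I\<close> the curve may leave the carrier, so the expansion into
    a sum holds only on \<open>I\<close>. This suffices because the derivative is taken within
    \<open>I\<close>.\<close>
  have "\<And>s. s \<in> I \<Longrightarrow> (A *\<^sub>v u s) $ i = (\<Sum>j<n. A $$ (i, j) * u s $ j)"
    using uv expand unfolding has_grid_derivative_def by blast
  then show "((\<lambda>s. (A *\<^sub>v u s) $ i) has_real_derivative (A *\<^sub>v v t) $ i) (at t within I)"
    by (intro has_field_derivative_transform_within[OF D, of 1] t) simp_all
qed (use A uv in \<open>auto simp: has_grid_derivative_def\<close>)

text \<open>A diagonal weight makes the bilinear form symmetric, so the two halves of the product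
  rule coincide; hence the factor 2.\<close>

lemma weighted_norm_sq_has_real_derivative:
  assumes uv: "has_grid_derivative n I u v" and t: "t \<in> I"
  shows "((\<lambda>s. weighted_norm_sq (mat_diag n w) (u s)) has_real_derivative
           2 * weighted_inner (mat_diag n w) (u t) (v t)) (at t within I)"
proof (rule has_field_derivative_transform_within[where d = 1])
  show "(\<Sum>i<n. w i * (u s $ i * u s $ i)) = weighted_norm_sq (mat_diag n w) (u s)"
    if "s \<in> I" for s
    using that uv by (simp add: weighted_norm_sq_def weighted_inner_mat_diag has_grid_derivative_def)
  have "((\<lambda>s. \<Sum>i<n. w i * (u s $ i * u s $ i)) has_real_derivative
      (\<Sum>i<n. w i * (u t $ i * v t $ i + v t $ i * u t $ i))) (at t within I)"
    using uv t unfolding has_grid_derivative_def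
    by (intro DERIV_sum DERIV_cmult DERIV_mult') auto
  moreover have "(\<Sum>i<n. w i * (u t $ i * v t $ i + v t $ i * u t $ i))
      = 2 * weighted_inner (mat_diag n w) (u t) (v t)"
    using uv t unfolding has_grid_derivative_def
    by (simp add: weighted_inner_mat_diag sum_distrib_left algebra_simps)
  ultimately show "((\<lambda>s. \<Sum>i<n. w i * (u s $ i * u s $ i)) has_real_derivative
      2 * weighted_inner (mat_diag n w) (u t) (v t)) (at t within I)"
    by simp
qed (use t in simp_all)

lemma grid_point_mem:
  assumes "xL < xR" and "i < N" and "2 \<le> N"
  shows "grid_point xL xR N i \<in> {xL..xR}"
proof -
  have "real i / (real N - 1) \<le> 1" using assms by auto
  then have "real i / (real N - 1) * (xR - xL) \<le> 1 * (xR - xL)"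
    using assms by (intro mult_right_mono) auto
  then show ?thesis
    using assms by (auto simp: grid_point_def grid_spacing_def)
qed

text \<open>Testing positive definiteness on \<open>unit_vec N i\<close> isolates the i-th diagonal
  entry. The grid spacing is absorbed into \<open>w\<close>. Positivity makes \<open>H\<close>
  invertible and lets its weights cancel against the penalty factors.\<close>

lemma dp_sbp_at_weights:
  assumes "dp_sbp_at xL xR p N Dm Dp H"
  obtains w where "H = mat_diag N w" and "\<And>i. i < N \<Longrightarrow> w i > 0"
proof -
  obtain h where h: "H = mat_diag N (\<lambda>i. h i * grid_spacing xL xR N)"
    and pos: "\<And>f. f \<in> carrier_vec N \<Longrightarrow> f \<noteq> 0\<^sub>v N \<Longrightarrow> weighted_inner H f f > 0"
    using assms unfolding dp_sbp_at_def by auto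
  define w where "w = (\<lambda>i. h i * grid_spacing xL xR N)"
  have "w i > 0" if i: "i < N" for i
  proof -
    have "unit_vec N i \<noteq> (0\<^sub>v N :: real vec)"
      using i by (metis index_unit_vec(1) index_zero_vec(1) zero_neq_one)
    then have "0 < (\<Sum>j<N. w j * (unit_vec N i $ j * unit_vec N i $ j))"
      using pos[of "unit_vec N i"] unfolding h by (simp add: weighted_inner_mat_diag w_def)
    also have "\<dots> = (\<Sum>j<N. if j = i then w j else 0)"
      using i by (intro sum.cong) auto
    finally show ?thesis using i by simp
  qed
  with that h show thesis by (simp add: w_def)
qed

text \<open>Each quotient of boundary parameters has the sign of the corresponding product, with x /
  0 = 0 by convention.\<close>

lemma boundary_term_nonneg:
  assumes "\<alpha>L * \<beta>L \<le> 0" and "\<alpha>R * \<beta>R \<ge> 0"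
  shows "boundary_term N \<alpha>L \<beta>L \<alpha>R \<beta>R ut t \<ge> 0"
proof -
  have "\<beta>L / \<alpha>L \<le> 0" and "\<beta>R / \<alpha>R \<ge> 0"
    using assms by (auto simp: mult_le_0_iff zero_le_mult_iff divide_le_0_iff zero_le_divide_iff)
  then have "\<beta>L / \<alpha>L * (ut t $ 0)\<^sup>2 \<le> 0" and "\<beta>R / \<alpha>R * (ut t $ (N - 1))\<^sup>2 \<ge> 0"
    by (simp_all only: mult_nonpos_nonneg mult_nonneg_nonneg zero_le_power2)
  then show ?thesis by (simp add: boundary_term_def)
qed

text \<open>The rank-one factor keeps only component \<open>k\<close> of \<open>x\<close> and places
  it in row \<open>k\<close>; the diagonal factors then scale it. The denominator \<open>w i\<close>
  is what the weight of the inner product cancels in the energy estimate.\<close>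

lemma penalty_term_component:
  fixes c w :: "nat \<Rightarrow> real"
  assumes "i < n" and "k < n" and "x \<in> carrier_vec n" and "\<And>i. i < n \<Longrightarrow> w i \<noteq> 0"
  shows "((((mat_diag n c) ^\<^sub>m 2) * matinv (mat_diag n w)
            * outer_product (unit_vec n k) (unit_vec n k)) *\<^sub>v x) $ i
         = (if i = k then (c i)\<^sup>2 / w i * x $ k else 0)"
proof -
  let ?O = "outer_product (unit_vec n k) (unit_vec n k) :: real mat"
  have O: "?O \<in> carrier_mat n n" by (simp add: outer_product_def)
  have M: "((mat_diag n c) ^\<^sub>m 2) * matinv (mat_diag n w)
      = mat_diag n (\<lambda>i. (c i)\<^sup>2 / w i)"
    using assms(4)
    by (simp add: matinv_mat_diag numeral_2_eq_2 divide_inverse)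
  have "?O *\<^sub>v x = x $ k \<cdot>\<^sub>v unit_vec n k"
    using assms by (simp add: outer_product_mult_vec)
  then show ?thesis
    unfolding M using assms O
    by (simp add: assoc_mult_mat_vec[OF mat_diag_dim O] mat_diag_mult_vec)
qed

text \<open>The algebra of the energy method at one instant. Here \<open>v\<close> and
  \<open>a\<close> are velocity and acceleration, \<open>z\<close> stands for Dm u,
  \<open>z'\<close> for Dm v and \<open>y\<close> for Dp z, while \<open>bL\<close> and
  \<open>bR\<close> are the ratios \<beta> / \<alpha>, not boundary data.\<close>

lemma energy_rate:
  fixes c \<sigma> w :: "nat \<Rightarrow> real"
  assumes w: "\<And>i. i < n \<Longrightarrow> w i \<noteq> 0" and c: "\<And>i. i < n \<Longrightarrow> c i \<noteq> 0" and n: "0 < n"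
    and y: "y \<in> carrier_vec n" and z: "z \<in> carrier_vec n" and z': "z' \<in> carrier_vec n"
    and v: "v \<in> carrier_vec n" and a: "a \<in> carrier_vec n"
    and sbp: "weighted_inner (mat_diag n w) y v + weighted_inner (mat_diag n w) z z'
        = z $ (n - 1) * v $ (n - 1) - z $ 0 * v $ 0"
    and scheme: "\<And>i. i < n \<Longrightarrow> a $ i + (\<sigma> i)\<^sup>2 * v $ i = (c i)\<^sup>2 * y $ i
        + (if i = 0 then (c i)\<^sup>2 / w i * (z $ 0 + bL * v $ 0) else 0)
        - (if i = n - 1 then (c i)\<^sup>2 / w i * (z $ (n - 1) + bR * v $ (n - 1)) else 0)"
  shows "weighted_inner (mat_diag n w) (mat_diag n (\<lambda>i. inverse (c i)) *\<^sub>v v)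
            (mat_diag n (\<lambda>i. inverse (c i)) *\<^sub>v a)
         + weighted_inner (mat_diag n w) z z'
       = - (weighted_norm_sq (mat_diag n w) (mat_diag n (\<lambda>i. inverse (c i) * \<sigma> i) *\<^sub>v v)
            + (bR * (v $ (n - 1))\<^sup>2 - bL * (v $ 0)\<^sup>2))"
proof -
  \<comment> \<open>The penalties after multiplication by w v / c^2 at each node: their factor c^2 /
    w cancels, leaving pure point values at the two ends.\<close>
  let ?L = "\<lambda>i. if i = 0 then v $ 0 * (z $ 0 + bL * v $ 0) else 0"
  let ?R = "\<lambda>i. if i = n - 1 then v $ (n - 1) * (z $ (n - 1) + bR * v $ (n - 1)) else 0"
  have summand: "w i * ((inverse (c i) * v $ i) * (inverse (c i) * a $ i))
      = w i * (y $ i * v $ i)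
        - w i * ((inverse (c i) * \<sigma> i * v $ i) * (inverse (c i) * \<sigma> i * v $ i)) + ?L i - ?R i"
    if i: "i < n" for i
  proof -
    have a_eq: "a $ i = (c i)\<^sup>2 * y $ i - (\<sigma> i)\<^sup>2 * v $ i
        + (if i = 0 then (c i)\<^sup>2 / w i * (z $ 0 + bL * v $ 0) else 0)
        - (if i = n - 1 then (c i)\<^sup>2 / w i * (z $ (n - 1) + bR * v $ (n - 1)) else 0)"
      using scheme[OF i] by linarith
    show ?thesis unfolding a_eq using w[OF i] c[OF i]
      by (auto simp: field_simps power2_eq_square)
  qed
  have "weighted_inner (mat_diag n w) (mat_diag n (\<lambda>i. inverse (c i)) *\<^sub>v v)
            (mat_diag n (\<lambda>i. inverse (c i)) *\<^sub>v a)
      = (\<Sum>i<n. w i * ((inverse (c i) * v $ i) * (inverse (c i) * a $ i)))"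
    using v a by (simp add: weighted_inner_mat_diag mat_diag_mult_vec)
  also have "\<dots> = (\<Sum>i<n. w i * (y $ i * v $ i)
        - w i * ((inverse (c i) * \<sigma> i * v $ i) * (inverse (c i) * \<sigma> i * v $ i)) + ?L i - ?R i)"
    using summand by (intro sum.cong) auto
  also have "\<dots> = weighted_inner (mat_diag n w) y v
      - weighted_norm_sq (mat_diag n w) (mat_diag n (\<lambda>i. inverse (c i) * \<sigma> i) *\<^sub>v v)
      + sum ?L {..<n} - sum ?R {..<n}"
    using v y by (simp add: weighted_norm_sq_def weighted_inner_mat_diag mat_diag_mult_vec
        sum.distrib sum_subtractf)
  also have "sum ?L {..<n} = v $ 0 * (z $ 0 + bL * v $ 0)" using n by simp
  also have "sum ?R {..<n} = v $ (n - 1) * (z $ (n - 1) + bR * v $ (n - 1))" using n by simp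
  \<comment> \<open>By \<open>sbp\<close>, the interior products reduce to end-point products of
    \<open>z\<close> and \<open>v\<close>. These cancel the \<open>z\<close> parts of the two
    penalty sums, so only the terms quadratic in \<open>v\<close> and the damping remain.\<close>
  finally show ?thesis using sbp by (simp add: algebra_simps power2_eq_square)
qed

theorem theorem5:
  fixes xL xR T :: real
    and N N0 p :: nat
    and Dm Dp H :: "nat \<Rightarrow> real mat"
    and c \<sigma> bL bR :: "real \<Rightarrow> real"
    and \<alpha>L \<beta>L \<alpha>R \<beta>R \<tau>L \<tau>R :: real
    and f g :: "real vec"
    and S u ut utt :: "real \<Rightarrow> real vec"
  assumes "xL < xR" and "0 < T" and "2 \<le> N0" and "N0 \<le> N"
    and "dp_sbp xL xR p N0 Dm Dp H"
    and "\<forall>x\<in>{xL..xR}. c x \<noteq> 0"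
    and "\<tau>L = 1" and "\<tau>R = - 1"
    and "\<forall>t\<in>{0..T}. bL t = 0" and "\<forall>t\<in>{0..T}. bR t = 0"
    and "\<forall>t\<in>{0..T}. S t = 0\<^sub>v N"
    and "\<alpha>L\<^sup>2 + \<beta>L\<^sup>2 \<noteq> 0" and "\<alpha>R\<^sup>2 + \<beta>R\<^sup>2 \<noteq> 0"
    and "\<alpha>L * \<beta>L \<le> 0" and "\<alpha>R * \<beta>R \<ge> 0"
    and "\<alpha>L \<noteq> 0" and "\<alpha>R \<noteq> 0"
    and "f \<in> carrier_vec N" and "g \<in> carrier_vec N"
    and "semidiscrete_solution xL xR N (Dm N) (Dp N) (H N) c \<sigma> S
           \<tau>L \<tau>R \<alpha>L \<beta>L \<alpha>R \<beta>R bL bR f g T u ut utt"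
  shows "\<forall>t\<in>{0..T}.
      (\<lambda>s. weighted_norm_sq (H N)
              ((matinv (grid_diag xL xR N c) * grid_diag xL xR N \<sigma>) *\<^sub>v ut s)
            + boundary_term N \<alpha>L \<beta>L \<alpha>R \<beta>R ut s) integrable_on {0..t} \<and>
      semidiscrete_energy xL xR N (Dm N) (H N) c u ut t
        + integral {0..t} (\<lambda>s. weighted_norm_sq (H N)
              ((matinv (grid_diag xL xR N c) * grid_diag xL xR N \<sigma>) *\<^sub>v ut s)
            + boundary_term N \<alpha>L \<beta>L \<alpha>R \<beta>R ut s)
        = semidiscrete_energy xL xR N (Dm N) (H N) c u ut 0 \<and>
      boundary_term N \<alpha>L \<beta>L \<alpha>R \<beta>R ut t \<ge> 0"
proof -
  have N: "2 \<le> N" using assms by simp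
  have at: "dp_sbp_at xL xR p N (Dm N) (Dp N) (H N)"
    using assms unfolding dp_sbp_def by blast
  obtain w where H: "H N = mat_diag N w" and w: "\<And>i. i < N \<Longrightarrow> w i > 0"
    using dp_sbp_at_weights[OF at] by blast
  have Dm: "Dm N \<in> carrier_mat N N" and Dp: "Dp N \<in> carrier_mat N N"
    and sbp: "\<And>f g. f \<in> carrier_vec N \<Longrightarrow> g \<in> carrier_vec N \<Longrightarrow>
        weighted_inner (H N) (Dp N *\<^sub>v f) g + weighted_inner (H N) f (Dm N *\<^sub>v g)
          = f $ (N - 1) * g $ (N - 1) - f $ 0 * g $ 0"
    using at unfolding dp_sbp_at_def by blast+
  define ci where "ci = (\<lambda>i. c (grid_point xL xR N i))"
  define si where "si = (\<lambda>i. \<sigma> (grid_point xL xR N i))"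
  have c: "ci i \<noteq> 0" if "i < N" for i
    using grid_point_mem[OF assms(1) that N] assms(6) by (auto simp: ci_def)
  have C: "grid_diag xL xR N c = mat_diag N ci" and Sg: "grid_diag xL xR N \<sigma> = mat_diag N si"
    by (simp_all add: grid_diag_def ci_def si_def)
  have Cinv: "matinv (mat_diag N ci) = mat_diag N (\<lambda>i. inverse (ci i))"
    using c by (rule matinv_mat_diag)
  have du: "has_grid_derivative N {0..T} u ut" and dut: "has_grid_derivative N {0..T} ut utt"
    using assms(20) unfolding semidiscrete_solution_def by blast+
  have uc: "u t \<in> carrier_vec N" "ut t \<in> carrier_vec N" "utt t \<in> carrier_vec N"
    if "t \<in> {0..T}" for t
    using du dut that unfolding has_grid_derivative_def by blast+
  let ?D = "\<lambda>s. weighted_norm_sq (H N)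
              ((matinv (grid_diag xL xR N c) * grid_diag xL xR N \<sigma>) *\<^sub>v ut s)
            + boundary_term N \<alpha>L \<beta>L \<alpha>R \<beta>R ut s"
  let ?E = "semidiscrete_energy xL xR N (Dm N) (H N) c u ut"
  have deriv: "(?E has_real_derivative - ?D t) (at t within {0..T})" if t: "t \<in> {0..T}" for t
  proof -
    let ?z = "Dm N *\<^sub>v u t" and ?Ci = "mat_diag N (\<lambda>i. inverse (ci i))"
    have z: "?z \<in> carrier_vec N" and z': "Dm N *\<^sub>v ut t \<in> carrier_vec N"
      using Dm uc[OF t] by auto
    have y: "Dp N *\<^sub>v ?z \<in> carrier_vec N" using Dp z by auto
    \<comment> \<open>One template for both penalties: \<open>k\<close> is the boundary node,
      \<open>b\<close> the ratio \<beta> / \<alpha> and \<open>e\<close> the factor 1 / \<alpha> in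
      front of the vanishing datum, which is kept as a zero multiple to match the scheme.\<close>
    let ?P = "\<lambda>k b e. (((mat_diag N ci) ^\<^sub>m 2) * matinv (mat_diag N w)
            * outer_product (unit_vec N k) (unit_vec N k)) *\<^sub>v
              (?z + b \<cdot>\<^sub>v ut t - e \<cdot>\<^sub>v (0 \<cdot>\<^sub>v unit_vec N k))"
    define PL where "PL = ?P 0 (\<beta>L / \<alpha>L) (1 / \<alpha>L)"
    define PR where "PR = ?P (N - 1) (\<beta>R / \<alpha>R) (1 / \<alpha>R)"
    have eq: "utt t + ((mat_diag N si) ^\<^sub>m 2) *\<^sub>v ut t =
        ((mat_diag N ci) ^\<^sub>m 2 * Dp N * Dm N) *\<^sub>v u t + 0\<^sub>v N
        + 1 \<cdot>\<^sub>v PL + (- 1) \<cdot>\<^sub>v PR"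
      using assms(20) t assms(9,10,11) unfolding semidiscrete_solution_def Let_def C Sg H PL_def PR_def
      by (simp add: assms(7,8))
    have P: "?P k b e $ i
        = (if i = k then (ci i)\<^sup>2 / w i * (?z $ k + b * ut t $ k) else 0)"
      if "i < N" "k < N" for i k b e
    proof -
      have "?z + b \<cdot>\<^sub>v ut t - e \<cdot>\<^sub>v (0 \<cdot>\<^sub>v unit_vec N k) \<in> carrier_vec N"
        using z uc[OF t] by auto
      then show ?thesis
        using that z uc[OF t] w Dm by (subst penalty_term_component) force+
    qed
    have Pdim: "dim_vec PL = N" "dim_vec PR = N"
      by (simp_all add: PL_def PR_def numeral_2_eq_2 mat_diag_def)
    \<comment> \<open>Reassociating the product exposes Dp applied to \<open>?z\<close>, the form in
      which summation by parts applies with \<open>?z\<close> and the velocity as arguments.\<close>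
    have interior: "(((mat_diag N ci) ^\<^sub>m 2 * Dp N * Dm N) *\<^sub>v u t)
        = vec N (\<lambda>i. (ci i)\<^sup>2 * (Dp N *\<^sub>v ?z) $ i)"
    proof -
      have sq: "(mat_diag N ci) ^\<^sub>m 2 = mat_diag N (\<lambda>i. (ci i)\<^sup>2)"
        by (simp add: numeral_2_eq_2)
      have MDp: "mat_diag N (\<lambda>i. (ci i)\<^sup>2) * Dp N \<in> carrier_mat N N"
        using mat_diag_dim Dp by (rule mult_carrier_mat)
      show ?thesis
        unfolding sq assoc_mult_mat_vec[OF MDp Dm uc(1)[OF t]]
          assoc_mult_mat_vec[OF mat_diag_dim Dp z]
        using y by (rule mat_diag_mult_vec)
    qed
    have damping: "((mat_diag N si) ^\<^sub>m 2) *\<^sub>v ut t = vec N (\<lambda>i. (si i)\<^sup>2 * ut t $ i)"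
      using uc[OF t] by (simp add: numeral_2_eq_2 mat_diag_mult_vec)
    have scheme: "utt t $ i + (si i)\<^sup>2 * ut t $ i = (ci i)\<^sup>2 * (Dp N *\<^sub>v ?z) $ i
        + (if i = 0 then (ci i)\<^sup>2 / w i * (?z $ 0 + \<beta>L / \<alpha>L * ut t $ 0) else 0)
        - (if i = N - 1 then (ci i)\<^sup>2 / w i * (?z $ (N - 1) + \<beta>R / \<alpha>R * ut t $ (N - 1)) else 0)"
      if i: "i < N" for i
    proof -
      have k: "0 < N" "N - 1 < N" using N by auto
      have "utt t $ i + (si i)\<^sup>2 * ut t $ i = (ci i)\<^sup>2 * (Dp N *\<^sub>v ?z) $ i + PL $ i - PR $ i"
        using arg_cong[OF eq, of "\<lambda>x. x $ i"] i
        unfolding interior damping by (simp add: Pdim del: index_mult_mat_vec)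
      then show ?thesis
        unfolding PL_def PR_def P[OF i k(1)] P[OF i k(2)] .
    qed
    have rate: "weighted_inner (H N) (?Ci *\<^sub>v ut t) (?Ci *\<^sub>v utt t)
        + weighted_inner (H N) ?z (Dm N *\<^sub>v ut t) = - ?D t"
      unfolding C Sg Cinv mat_diag_diag boundary_term_def H
      using N w c y z z' uc(2,3)[OF t] sbp[OF z uc(2)[OF t]] scheme
      by (intro energy_rate[where y = "Dp N *\<^sub>v ?z"]) (force simp: H)+
    \<comment> \<open>The matrices do not depend on time and so commute with differentiation; the
      factor 1/2 of the energy cancels the 2 from each squared norm.\<close>
    have "(?E has_real_derivative 1 / 2 * (2 * weighted_inner (H N) (?Ci *\<^sub>v ut t) (?Ci *\<^sub>v utt t)
        + 2 * weighted_inner (H N) ?z (Dm N *\<^sub>v ut t))) (at t within {0..T})"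
      unfolding semidiscrete_energy_def C Cinv H
      by (intro DERIV_cmult DERIV_add weighted_norm_sq_has_real_derivative[OF _ t]
          has_grid_derivative_mult_mat_vec du dut Dm mat_diag_dim)
    then show ?thesis unfolding rate[symmetric] by (simp add: algebra_simps)
  qed
  show ?thesis
  proof (intro ballI)
    fix t assume t: "t \<in> {0..T}"
    \<comment> \<open>For the gauge integral, differentiability of the energy yields both the
      existence of the integral of its derivative and its value. The derivative within
      \<open>{0..T}\<close> restricts to \<open>{0..t}\<close>.\<close>
    have "((\<lambda>s. - ?D s) has_integral ?E t - ?E 0) {0..t}"
    proof (rule fundamental_theorem_of_calculus)
      fix s assume "s \<in> {0..t}"
      then show "(?E has_vector_derivative - ?D s) (at s within {0..t})"
        using t deriv[of s]
        by (auto simp: has_real_derivative_iff_has_vector_derivative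
            intro: has_vector_derivative_within_subset)
    qed (use t in auto)
    from has_integral_neg[OF this] have D: "(?D has_integral - (?E t - ?E 0)) {0..t}"
      unfolding minus_minus .
    show "?D integrable_on {0..t} \<and> ?E t + integral {0..t} ?D = ?E 0 \<and>
        boundary_term N \<alpha>L \<beta>L \<alpha>R \<beta>R ut t \<ge> 0"
      using boundary_term_nonneg[OF assms(14,15)] has_integral_integrable[OF D]
      unfolding integral_unique[OF D] by simp
  qed
qed

end
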